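(* Let $0<\alpha\le 2$, $\nu>0$, let $(a_z)_{z\ge1}$ and $\theta>0$ be as in the context, and let $F(\cdot;\alpha,\nu,\theta)$ be the cdf of the rGTL-PS distribution. The quantile $y_q$ of the rGTL-PS distribution, defined by $q=F(y_q;\alpha,\nu,\theta)$, is given by $$y_q=G^{-1}\!\left(1-\frac{A^{-1}[(1-q)A(\theta)]}{\theta};\alpha,\nu\right)=\begin{cases}1-\dfrac{\alpha-\sqrt{\alpha^2-4(\alpha-1)\left(\frac{A^{-1}[(1-q)A(\theta)]}{\theta}\right)^{1/\nu}}}{2(\alpha-1)}, & 1<\alpha\le 2,\\[3mm] 1-\left(\dfrac{A^{-1}[(1-q)A(\theta)]}{\theta}\right)^{1/\nu}, & \alpha=1,\\[3mm] 1-\dfrac{\alpha+\sqrt{\alpha^2-4(\alpha-1)\left(\frac{A^{-1}[(1-q)A(\theta)]}{\theta}\right)^{1/\nu}}}{2(\alpha-1)}, & 0<\alpha<1.\end{cases}$$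
   Context: For $0<\alpha\le 2$ and $\nu>0$, $G(y;\alpha,\nu)=1-(1-y)^{\nu}[\alpha-(\alpha-1)(1-y)]^{\nu}$, $0\le y\le1$, is the cdf of the reflected Generalized Topp-Leone distribution rGTL$(\alpha,\nu)$, and $G^{-1}(\cdot;\alpha,\nu)$ denotes its inverse (quantile) function. Let $a_z\ge 0$ ($z=1,2,\dots$) and $\theta>0$ be such that $A(\theta)=\sum_{z=1}^{\infty}a_z\theta^z$ is finite (and nonzero, so that $a_z\theta^z/A(\theta)$ is a probability function on $z=1,2,\dots$). $A^{-1}$ denotes the inverse of the function $t\mapsto A(t)=\sum_{z\ge1}a_zt^z$. The rGTL-PS (reflected Generalized Topp-Leone Power Series) distribution with parameters $(\alpha,\nu,\theta)$ is the distribution on $[0,1]$ with cdf $F(y;\alpha,\nu,\theta)=1-A\{\theta[1-G(y;\alpha,\nu)]\}/A(\theta)$.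
   Formalization: In the case 0<α<1 the printed formula has α+√(…), which always gives y_q>1 (e.g. α=1/2, ν=1, q=0 gives 3 instead of 0); the formal statement has α−√(…) there. All else is as printed, with q in [0,1] and y_q sought in [0,1]. *)

theory Defs
  imports Complex_Main
begin

definition rGTL_cdf :: "real \<Rightarrow> real \<Rightarrow> real \<Rightarrow> real" where
  "rGTL_cdf \<alpha> \<nu> y = 1 - (1 - y) powr \<nu> * (\<alpha> - (\<alpha> - 1) * (1 - y)) powr \<nu>"

(* The support [0,1] is where the formula above is the cdf, so G is inverted there. *)
definition rGTL_quantile :: "real \<Rightarrow> real \<Rightarrow> real \<Rightarrow> real" where
  "rGTL_quantile \<alpha> \<nu> = the_inv_into {0..1} (rGTL_cdf \<alpha> \<nu>)"

(* The coefficients are a 1, a 2, ...; the value a 0 is never used. *)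
definition ps_domain :: "(nat \<Rightarrow> real) \<Rightarrow> real set" where
  "ps_domain a = {t. 0 \<le> t \<and> summable (\<lambda>z. a (Suc z) * t ^ Suc z)}"

definition ps_sum :: "(nat \<Rightarrow> real) \<Rightarrow> real \<Rightarrow> real" where
  "ps_sum a t = (\<Sum>z. a (Suc z) * t ^ Suc z)"

definition ps_inv :: "(nat \<Rightarrow> real) \<Rightarrow> real \<Rightarrow> real" where
  "ps_inv a = the_inv_into (ps_domain a) (ps_sum a)"

definition rGTL_PS_cdf :: "real \<Rightarrow> real \<Rightarrow> (nat \<Rightarrow> real) \<Rightarrow> real \<Rightarrow> real \<Rightarrow> real" where
  "rGTL_PS_cdf \<alpha> \<nu> a \<theta> y = 1 - ps_sum a (\<theta> * (1 - rGTL_cdf \<alpha> \<nu> y)) / ps_sum a \<theta>"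

(* With u = 1 - y and w = (A^-1[(1-q)A(theta)]/theta) powr (1/nu), the quantile equation
   q = F(y) becomes (alpha - 1) u^2 - alpha u + w = 0. For alpha < 1 the source prints the root
   u = (alpha + sqrt ...)/(2(alpha - 1)). By the lemma below that root gives y > 1, outside the
   support, for every w >= 0, so the printed sign is an error; the root with y in [0,1] is
   u = (alpha - sqrt ...)/(2(alpha - 1)), exactly as for alpha > 1. *)
lemma plus_root_gt_1:
  fixes \<alpha> w :: real
  assumes "0 < \<alpha>" "\<alpha> < 1" "0 \<le> w"
  shows "1 < 1 - (\<alpha> + sqrt (\<alpha>\<^sup>2 - 4 * (\<alpha> - 1) * w)) / (2 * (\<alpha> - 1))"
proof -
  have "(\<alpha> - 1) * w \<le> 0"
    using assms by (simp add: mult_nonpos_nonneg)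
  then have "0 \<le> \<alpha>\<^sup>2 - 4 * (\<alpha> - 1) * w"
    using zero_le_power2[of \<alpha>] by (simp only: mult.assoc)
  then have "0 < \<alpha> + sqrt (\<alpha>\<^sup>2 - 4 * (\<alpha> - 1) * w)"
    using assms by (simp add: add_pos_nonneg)
  then have "(\<alpha> + sqrt (\<alpha>\<^sup>2 - 4 * (\<alpha> - 1) * w)) / (2 * (\<alpha> - 1)) < 0"
    using assms by (intro divide_pos_neg) auto
  then show ?thesis by simp
qed

end

(* With u = 1 - y, the cdf G is 1 - (u (\<alpha> - (\<alpha> - 1) u)) powr \<nu>, and the quadratic is strictly increasing
   on [0,1] exactly because \<alpha> \<le> 2. As A is strictly increasing and continuous on [0,\<theta>], F is a
   continuous increasing bijection of [0,1], so q = F(y) unwinds to \<theta> (1 - G(y)) = A^-1[(1-q) A(\<theta>)].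
   In the quadratic formula for u the discriminant is the square of \<alpha> - 2 (\<alpha> - 1) u, which is
   nonnegative on [0,1]; this selects the root with the minus sign for all \<alpha> \<noteq> 1. *)
theory Submission
  imports Defs "HOL-Analysis.Uniform_Limit"
begin

lemma ps_sum_0: "ps_sum a 0 = 0"
  by (simp add: ps_sum_def)

text \<open>Comparison with the series at \<open>\<theta>\<close>. It places the whole interval
  [0,\<open>\<theta>\<close>] inside \<open>ps_domain a\<close>, the set on which
  \<open>ps_inv\<close> inverts the power series.\<close>

lemma summable_powser_mono:
  fixes a :: "nat \<Rightarrow> real"
  assumes "\<And>z. 1 \<le> z \<Longrightarrow> 0 \<le> a z" and "summable (\<lambda>z. a (Suc z) * \<theta> ^ Suc z)"
    and "0 \<le> t" and "t \<le> \<theta>"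
  shows "summable (\<lambda>z. a (Suc z) * t ^ Suc z)"
proof (rule summable_comparison_test'[OF assms(2), of 0])
  fix z
  show "norm (a (Suc z) * t ^ Suc z) \<le> a (Suc z) * \<theta> ^ Suc z"
    using assms(1)[of "Suc z"] assms(3,4)
    by (simp add: abs_mult mult_left_mono power_mono del: power_Suc)
qed

text \<open>Every term is weakly increasing in t, and the term of the single positive coefficient is
  strictly increasing, so the series of differences has a positive sum.\<close>

lemma strict_mono_on_ps_sum:
  assumes nonneg: "\<And>z. 1 \<le> z \<Longrightarrow> 0 \<le> a z"
    and pos: "1 \<le> k" "0 < a k"
  shows "strict_mono_on (ps_domain a) (ps_sum a)"
proof (rule strict_mono_onI)
  fix s t
  assume s: "s \<in> ps_domain a" and t: "t \<in> ps_domain a" and "s < t"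
  have "0 \<le> s" using s by (simp add: ps_domain_def)
  obtain j where j: "k = Suc j" using pos(1) by (cases k) auto
  have le: "a (Suc z) * s ^ Suc z \<le> a (Suc z) * t ^ Suc z" for z
    using nonneg[of "Suc z"] \<open>0 \<le> s\<close> \<open>s < t\<close>
    by (intro mult_left_mono power_mono) auto
  have less: "a (Suc j) * s ^ Suc j < a (Suc j) * t ^ Suc j"
    using pos(2) \<open>0 \<le> s\<close> \<open>s < t\<close> unfolding j
    by (intro mult_strict_left_mono power_strict_mono) auto
  have "summable (\<lambda>z. a (Suc z) * t ^ Suc z - a (Suc z) * s ^ Suc z)"
    using s t by (intro summable_diff) (auto simp: ps_domain_def)
  then have "0 < (\<Sum>z. a (Suc z) * t ^ Suc z - a (Suc z) * s ^ Suc z)"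
    using le less by (intro suminf_pos2[where i = j]) (simp_all del: power_Suc)
  also have "\<dots> = ps_sum a t - ps_sum a s"
    unfolding ps_sum_def using s t
    by (intro suminf_diff[symmetric]) (auto simp: ps_domain_def)
  finally show "ps_sum a s < ps_sum a t" by simp
qed

text \<open>The terms at \<open>\<theta>\<close> serve as majorants in the Weierstrass test. This
  gives continuity up to and including \<open>\<theta>\<close>, even when \<open>\<theta>\<close> is
  the radius of convergence.\<close>

lemma continuous_on_ps_sum:
  assumes "\<And>z. 1 \<le> z \<Longrightarrow> 0 \<le> a z" and "summable (\<lambda>z. a (Suc z) * \<theta> ^ Suc z)"
  shows "continuous_on {0..\<theta>} (ps_sum a)"
proof -
  have "uniform_limit {0..\<theta>} (\<lambda>n t. \<Sum>z<n. a (Suc z) * t ^ Suc z) (ps_sum a) sequentially"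
    unfolding ps_sum_def
  proof (rule Weierstrass_m_test[OF _ assms(2)])
    fix z t
    assume "t \<in> {0..\<theta>}"
    then show "norm (a (Suc z) * t ^ Suc z) \<le> a (Suc z) * \<theta> ^ Suc z"
      using assms(1)[of "Suc z"]
      by (simp add: abs_mult mult_left_mono power_mono del: power_Suc)
  qed
  then show ?thesis
    by (rule uniform_limit_theorem[rotated])
      (auto intro!: always_eventually continuous_intros)
qed

text \<open>Both bases are nonnegative on [0,1], the second being \<alpha> y + (1 - y), so the two
  powers merge into one.\<close>

lemma rGTL_cdf_eq_quadratic_powr:
  assumes "0 < \<alpha>" and "y \<in> {0..1}"
  shows "rGTL_cdf \<alpha> \<nu> y = 1 - ((1 - y) * (\<alpha> - (\<alpha> - 1) * (1 - y))) powr \<nu>"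
proof -
  have "\<alpha> - (\<alpha> - 1) * (1 - y) = \<alpha> * y + (1 - y)" by algebra
  then have "0 \<le> \<alpha> - (\<alpha> - 1) * (1 - y)" using assms by simp
  then show ?thesis using assms by (simp add: rGTL_cdf_def powr_mult)
qed

text \<open>The difference of the two sides is (v - u) (\<alpha> - (\<alpha> - 1) (u + v)). For
  \<alpha> > 1 the second factor is positive because u + v < 2 and 2 (\<alpha> - 1) \<le> \<alpha>;
  for \<alpha> \<le> 1 it is at least \<alpha>.\<close>

lemma quadratic_strict_mono:
  fixes \<alpha> :: real
  assumes "0 < \<alpha>" "\<alpha> \<le> 2" "0 \<le> u" "u < v" "v \<le> 1"
  shows "u * (\<alpha> - (\<alpha> - 1) * u) < v * (\<alpha> - (\<alpha> - 1) * v)"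
proof -
  have "(\<alpha> - 1) * (u + v) < \<alpha>"
  proof (cases "1 < \<alpha>")
    case True
    then have "(\<alpha> - 1) * (u + v) < (\<alpha> - 1) * 2"
      using assms by (intro mult_strict_left_mono) auto
    then show ?thesis using assms by simp
  next
    case False
    then have "(\<alpha> - 1) * (u + v) \<le> 0"
      using assms by (intro mult_nonpos_nonneg) auto
    then show ?thesis using assms by simp
  qed
  then have "0 < (v - u) * (\<alpha> - (\<alpha> - 1) * (u + v))"
    using assms by (intro mult_pos_pos) auto
  also have "\<dots> = v * (\<alpha> - (\<alpha> - 1) * v) - u * (\<alpha> - (\<alpha> - 1) * u)" by algebra
  finally show ?thesis by simp
qed

lemma quadratic_root:
  fixes \<alpha> u :: real
  assumes "0 < \<alpha>" "\<alpha> \<le> 2" "\<alpha> \<noteq> 1" "0 \<le> u" "u \<le> 1"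
  shows "(\<alpha> - sqrt (\<alpha>\<^sup>2 - 4 * (\<alpha> - 1) * (u * (\<alpha> - (\<alpha> - 1) * u)))) / (2 * (\<alpha> - 1)) = u"
proof -
  \<comment> \<open>Both summands on the right are nonnegative for u in [0,1], the second by
    \<alpha> \<le> 2.\<close>
  have "\<alpha> - 2 * (\<alpha> - 1) * u = \<alpha> * (1 - u) + (2 - \<alpha>) * u" by algebra
  then have nonneg: "0 \<le> \<alpha> - 2 * (\<alpha> - 1) * u" using assms by simp
  have "\<alpha>\<^sup>2 - 4 * (\<alpha> - 1) * (u * (\<alpha> - (\<alpha> - 1) * u)) = (\<alpha> - 2 * (\<alpha> - 1) * u)\<^sup>2"
    by algebra
  then have "sqrt (\<alpha>\<^sup>2 - 4 * (\<alpha> - 1) * (u * (\<alpha> - (\<alpha> - 1) * u))) = \<alpha> - 2 * (\<alpha> - 1) * u"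
    using nonneg by simp
  then show ?thesis using assms(3) by simp
qed

lemma strict_mono_on_rGTL_cdf:
  assumes "0 < \<alpha>" "\<alpha> \<le> 2" "0 < \<nu>"
  shows "strict_mono_on {0..1} (rGTL_cdf \<alpha> \<nu>)"
proof (rule strict_mono_onI)
  fix x y :: real
  assume xy: "x \<in> {0..1}" "y \<in> {0..1}" "x < y"
  have "(1 - y) * (\<alpha> - (\<alpha> - 1) * (1 - y)) < (1 - x) * (\<alpha> - (\<alpha> - 1) * (1 - x))"
    using assms xy by (intro quadratic_strict_mono) auto
  \<comment> \<open>Monotonicity of the power needs a nonnegative base; comparison with the value 0
    of the quadratic at u = 0 supplies it.\<close>
  moreover have "0 \<le> (1 - y) * (\<alpha> - (\<alpha> - 1) * (1 - y))"
    using quadratic_strict_mono[of \<alpha> 0 "1 - y"] assms xy by (cases "y = 1") auto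
  ultimately show "rGTL_cdf \<alpha> \<nu> x < rGTL_cdf \<alpha> \<nu> y"
    using assms xy by (simp add: rGTL_cdf_eq_quadratic_powr powr_less_mono2)
qed

lemma rGTL_cdf_0: "rGTL_cdf \<alpha> \<nu> 0 = 0"
  by (simp add: rGTL_cdf_def)

lemma rGTL_cdf_1: "rGTL_cdf \<alpha> \<nu> 1 = 1"
  by (simp add: rGTL_cdf_def)

lemma rGTL_cdf_mem:
  assumes "0 < \<alpha>" "\<alpha> \<le> 2" "0 < \<nu>" "y \<in> {0..1}"
  shows "rGTL_cdf \<alpha> \<nu> y \<in> {0..1}"
proof -
  have "mono_on {0..1} (rGTL_cdf \<alpha> \<nu>)"
    using strict_mono_on_rGTL_cdf[OF assms(1-3)] by (rule strict_mono_on_imp_mono_on)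
  from mono_onD[OF this, of 0 y] mono_onD[OF this, of y 1] show ?thesis
    using assms(4) by (simp add: rGTL_cdf_0 rGTL_cdf_1)
qed

text \<open>The base 1 - y vanishes at y = 1, where continuity of the power relies on \<nu> > 0.
  Rewriting the other base as \<alpha> y + (1 - y) makes its sign evident.\<close>

lemma continuous_on_rGTL_cdf:
  assumes "0 < \<alpha>" "0 < \<nu>"
  shows "continuous_on {0..1} (rGTL_cdf \<alpha> \<nu>)"
proof -
  have eq: "\<alpha> - (\<alpha> - 1) * (1 - y) = \<alpha> * y + (1 - y)" for y by algebra
  have "continuous_on {0..1} (\<lambda>y. 1 - (1 - y) powr \<nu> * (\<alpha> * y + (1 - y)) powr \<nu>)"
    using assms by (intro continuous_intros continuous_on_powr') auto
  then show ?thesis by (simp add: rGTL_cdf_def eq)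
qed

theorem mainTheorem3:
  fixes \<alpha> \<nu> \<theta> q :: real and a :: "nat \<Rightarrow> real"
  assumes "0 < \<alpha>" and "\<alpha> \<le> 2" and "0 < \<nu>"
    and "\<And>z. 1 \<le> z \<Longrightarrow> 0 \<le> a z"
    and "0 < \<theta>"
    and "summable (\<lambda>z. a (Suc z) * \<theta> ^ Suc z)"
    and "ps_sum a \<theta> \<noteq> 0"
    and "0 \<le> q" and "q \<le> 1"
  shows "(\<exists>!y. y \<in> {0..1} \<and> q = rGTL_PS_cdf \<alpha> \<nu> a \<theta> y) \<and>
    (\<forall>y\<^sub>q \<in> {0..1}. q = rGTL_PS_cdf \<alpha> \<nu> a \<theta> y\<^sub>q \<longrightarrow>
      (let r = ps_inv a ((1 - q) * ps_sum a \<theta>) / \<theta> in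
        y\<^sub>q = rGTL_quantile \<alpha> \<nu> (1 - r) \<and>
        (1 < \<alpha> \<longrightarrow> y\<^sub>q = 1 - (\<alpha> - sqrt (\<alpha>\<^sup>2 - 4 * (\<alpha> - 1) * r powr (1 / \<nu>))) / (2 * (\<alpha> - 1))) \<and>
        (\<alpha> = 1 \<longrightarrow> y\<^sub>q = 1 - r powr (1 / \<nu>)) \<and>
        (\<alpha> < 1 \<longrightarrow> y\<^sub>q = 1 - (\<alpha> - sqrt (\<alpha>\<^sup>2 - 4 * (\<alpha> - 1) * r powr (1 / \<nu>))) / (2 * (\<alpha> - 1)))))"
proof -
  note params = assms(1-3)
  let ?G = "rGTL_cdf \<alpha> \<nu>" and ?F = "rGTL_PS_cdf \<alpha> \<nu> a \<theta>" and ?A = "ps_sum a"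
  have dom: "t \<in> ps_domain a" if "0 \<le> t" "t \<le> \<theta>" for t
    using summable_powser_mono[OF assms(4,6) that] that(1) by (simp add: ps_domain_def)
  have arg: "\<theta> * (1 - ?G y) \<in> {0..\<theta>}" if "y \<in> {0..1}" for y
    using rGTL_cdf_mem[OF params that] \<open>0 < \<theta>\<close> by (simp add: mult_left_le)
  have arg_dom: "\<theta> * (1 - ?G y) \<in> ps_domain a" if "y \<in> {0..1}" for y
    using dom arg[OF that] unfolding atLeastAtMost_iff by blast
  \<comment> \<open>Since A(\<open>\<theta>\<close>) is nonzero, not all coefficients vanish, and a
    nonzero one is positive.\<close>
  obtain k where k: "1 \<le> k" "0 < a k"
  proof -
    have "\<exists>z. a (Suc z) \<noteq> 0"
    proof (rule ccontr)
      assume "\<nexists>z. a (Suc z) \<noteq> 0"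
      then have "?A \<theta> = 0" by (simp add: ps_sum_def)
      with \<open>?A \<theta> \<noteq> 0\<close> show False ..
    qed
    then show thesis using that assms(4) by (metis le_add1 order_less_le plus_1_eq_Suc)
  qed
  have A_mono: "strict_mono_on (ps_domain a) ?A"
    using assms(4) k by (rule strict_mono_on_ps_sum)
  have A_pos: "0 < ?A \<theta>"
    using strict_mono_onD[OF A_mono dom[of 0] dom[of \<theta>]] \<open>0 < \<theta>\<close> by (simp add: ps_sum_0)
  have F_mono: "strict_mono_on {0..1} ?F"
  proof (rule strict_mono_onI)
    fix x y :: real
    assume xy: "x \<in> {0..1}" "y \<in> {0..1}" "x < y"
    have "?G x < ?G y"
      using strict_mono_onD[OF strict_mono_on_rGTL_cdf[OF params] xy] .
    \<comment> \<open>The order is reversed here and reversed back by the minus sign in front of A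
      in F.\<close>
    then have "\<theta> * (1 - ?G y) < \<theta> * (1 - ?G x)" using \<open>0 < \<theta>\<close> by simp
    then have "?A (\<theta> * (1 - ?G y)) < ?A (\<theta> * (1 - ?G x))"
      using xy by (intro strict_mono_onD[OF A_mono] arg_dom)
    then show "?F x < ?F y"
      using A_pos by (simp add: rGTL_PS_cdf_def divide_strict_right_mono)
  qed
  have F_cont: "continuous_on {0..1} ?F"
  proof -
    have "continuous_on {0..1} (\<lambda>y. ?A (\<theta> * (1 - ?G y)))"
      using arg
      by (intro continuous_on_compose2[OF continuous_on_ps_sum[OF assms(4,6)]]
          continuous_intros continuous_on_rGTL_cdf params) auto
    then show ?thesis
      unfolding rGTL_PS_cdf_def using A_pos by (intro continuous_intros) auto
  qed
  have "?F 0 = 0" "?F 1 = 1"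
    using A_pos by (simp_all add: rGTL_PS_cdf_def rGTL_cdf_0 rGTL_cdf_1 ps_sum_0)
  then obtain y where y: "y \<in> {0..1}" "?F y = q"
    using IVT'[of ?F 0 q 1] F_cont \<open>0 \<le> q\<close> \<open>q \<le> 1\<close> by auto
  have unique: "\<exists>!y. y \<in> {0..1} \<and> q = ?F y"
    using y inj_onD[OF strict_mono_on_imp_inj_on[OF F_mono]] by (intro ex1I[of _ y]) auto
  have formula: "let r = ps_inv a ((1 - q) * ?A \<theta>) / \<theta> in
        x = rGTL_quantile \<alpha> \<nu> (1 - r) \<and>
        (1 < \<alpha> \<longrightarrow> x = 1 - (\<alpha> - sqrt (\<alpha>\<^sup>2 - 4 * (\<alpha> - 1) * r powr (1 / \<nu>))) / (2 * (\<alpha> - 1))) \<and>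
        (\<alpha> = 1 \<longrightarrow> x = 1 - r powr (1 / \<nu>)) \<and>
        (\<alpha> < 1 \<longrightarrow> x = 1 - (\<alpha> - sqrt (\<alpha>\<^sup>2 - 4 * (\<alpha> - 1) * r powr (1 / \<nu>))) / (2 * (\<alpha> - 1)))"
    if x: "x \<in> {0..1}" "q = ?F x" for x
  proof -
    define u where "u = 1 - x"
    have u: "0 \<le> u" "u \<le> 1" "x = 1 - u" using x(1) by (auto simp: u_def)
    have "(1 - q) * ?A \<theta> = ?A (\<theta> * (1 - ?G x))"
      using x(2) A_pos by (simp add: rGTL_PS_cdf_def)
    \<comment> \<open>\<open>the_inv_into\<close> is meaningful only on the image of
      \<open>ps_domain a\<close>, so the argument must be known to lie in that set.\<close>
    then have "ps_inv a ((1 - q) * ?A \<theta>) = \<theta> * (1 - ?G x)"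
      unfolding ps_inv_def using x(1)
      by (simp only: the_inv_into_f_f[OF strict_mono_on_imp_inj_on[OF A_mono]] arg_dom)
    then have r: "ps_inv a ((1 - q) * ?A \<theta>) / \<theta> = 1 - ?G x"
      using \<open>0 < \<theta>\<close> by simp
    have "0 \<le> u * (\<alpha> - (\<alpha> - 1) * u)"
      using quadratic_strict_mono[of \<alpha> 0 u] params u by (cases "u = 0") auto
    \<comment> \<open>The exponents \<nu> and 1 / \<nu> cancel because the base is nonnegative; it
      may be 0, at x = 1.\<close>
    then have w: "(1 - ?G x) powr (1 / \<nu>) = u * (\<alpha> - (\<alpha> - 1) * u)"
      using params x(1) by (simp add: rGTL_cdf_eq_quadratic_powr powr_powr flip: u_def)
    have "rGTL_quantile \<alpha> \<nu> (?G x) = x"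
      unfolding rGTL_quantile_def
      using strict_mono_on_imp_inj_on[OF strict_mono_on_rGTL_cdf[OF params]] x(1)
      by (rule the_inv_into_f_f)
    \<comment> \<open>For \<alpha> = 1 the quadratic is just u; otherwise
      \<open>quadratic_root\<close> recovers u from it.\<close>
    then show ?thesis
      unfolding r Let_def w using quadratic_root[of \<alpha> u] params u by auto
  qed
  show ?thesis using unique formula by blast
qed

end
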